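(* For every network $N=(\Gamma,B)$, the Dirichlet matroid $M(N)$ has the half-plane property, i.e. its basis generating polynomial $\sum_{X \text{ basis of } M(N)}\prod_{e\in X}x_e$ has no zero $(x_e)$ with $\operatorname{Im}(x_e)>0$ for every element $e$ of the ground set.
   Context: A network $N=(\Gamma,B)$ consists of a finite connected graph $\Gamma=(V,E)$ with no loops or multiple edges and a set $B\subsetneq V$ of at least 2 vertices (boundary nodes), no two of which are adjacent; vertices in $V\setminus B$ are interior. The Dirichlet matroid $M(N)$ is defined as follows. Fix an injective $u:B\to\mathbb{R}$ and a new symbol $e_0\notin E$. Work in $\mathbb{R}^{(V\setminus B)\cup\{0\}}$ with standard basis vectors $\mathbf{e}_i$. Assign to each edge $ij\in E$ with $i,j$ interior the vector $\mathbf{e}_i-\mathbf{e}_j$, to each edge $ij$ with $i$ interior and $j\in B$ the vector $\mathbf{e}_i-u(j)\mathbf{e}_0$, and to $e_0$ the vector $\mathbf{e}_0$. (These are the normal vectors of the cone over the arrangement of hyperplanes $x_i=x_j$ and $x_i=u(j)$ in $\mathbb{R}^{V\setminus B}$.) $M(N)$ is the matroid on $E\cup\{e_0\}$ in which a set is independent iff its vectors are linearly independent; it does not depend on the choice of injective $u$. *)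

theory Defs
  imports "HOL-Analysis.Finite_Function_Topology"
begin

section \<open>Matroids and the half-plane property\<close>

locale matroid =
  fixes S :: "'a set" and indep :: "'a set \<Rightarrow> bool"
  assumes finite_ground: "finite S"
    and indep_subset_ground: "indep X \<Longrightarrow> X \<subseteq> S"
    and indep_empty: "indep {}"
    and indep_subset: "indep Y \<Longrightarrow> X \<subseteq> Y \<Longrightarrow> indep X"
    and indep_augment: "indep X \<Longrightarrow> indep Y \<Longrightarrow> card X < card Y \<Longrightarrow> \<exists>y\<in>Y - X. indep (insert y X)"

definition bases :: "('a set \<Rightarrow> bool) \<Rightarrow> 'a set set" where
  "bases indep = {X. indep X \<and> (\<forall>Y. indep Y \<and> X \<subseteq> Y \<longrightarrow> Y = X)}"

definition basis_gen_poly :: "('a set \<Rightarrow> bool) \<Rightarrow> ('a \<Rightarrow> complex) \<Rightarrow> complex" where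
  "basis_gen_poly indep x = (\<Sum>X\<in>bases indep. \<Prod>e\<in>X. x e)"

definition half_plane_property :: "'a set \<Rightarrow> ('a set \<Rightarrow> bool) \<Rightarrow> bool" where
  "half_plane_property S indep \<longleftrightarrow>
     matroid S indep \<and> (\<forall>x. (\<forall>e\<in>S. Im (x e) > 0) \<longrightarrow> basis_gen_poly indep x \<noteq> 0)"

text \<open>
  Independence of the family of vectors \<open>(w e)\<close> indexed by \<open>X\<close>: as \<^const>\<open>independent\<close> concerns sets
  of vectors, repetitions have to be excluded separately.
\<close>
definition vector_indep :: "'a set \<Rightarrow> ('a \<Rightarrow> 'b::real_vector) \<Rightarrow> 'a set \<Rightarrow> bool" where
  "vector_indep S w X \<longleftrightarrow> X \<subseteq> S \<and> inj_on w X \<and> independent (w ` X)"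

lemma matroid_vector_indep:
  assumes fin: "finite S"
  shows "matroid S (vector_indep S w)"
proof
  show "finite S" by (fact fin)
  show "X \<subseteq> S" if "vector_indep S w X" for X
    using that by (simp add: vector_indep_def)
  show "vector_indep S w {}"
    by (simp add: vector_indep_def independent_empty)
  show "vector_indep S w X" if "vector_indep S w Y" "X \<subseteq> Y" for X Y
    using that unfolding vector_indep_def
    by (meson image_mono independent_mono inj_on_subset subset_trans)
  show "\<exists>y\<in>Y - X. vector_indep S w (insert y X)"
    if X: "vector_indep S w X" and Y: "vector_indep S w Y" and less: "card X < card Y" for X Y
  proof (rule ccontr)
    assume neg: "\<not> ?thesis"
    have "w y \<in> span (w ` X)" if "y \<in> Y" for y
    proof (rule ccontr)
      assume *: "w y \<notin> span (w ` X)"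
      then have "w y \<notin> w ` X" using span_base by blast
      moreover from this have "y \<notin> X" by blast
      moreover have "independent (insert (w y) (w ` X))"
        using X * by (simp add: vector_indep_def independent_insert)
      ultimately have "vector_indep S w (insert y X)"
        using X Y \<open>y \<in> Y\<close> by (auto simp: vector_indep_def)
      with neg \<open>y \<in> Y\<close> \<open>y \<notin> X\<close> show False by blast
    qed
    then have sub: "w ` Y \<subseteq> span (w ` X)" by blast
    have "finite (w ` X)"
      using X fin by (meson finite_imageI finite_subset vector_indep_def)
    with sub Y have "card (w ` Y) \<le> card (w ` X)"
      using independent_span_bound unfolding vector_indep_def by blast
    with X Y less show False
      by (simp add: vector_indep_def card_image)
  qed
qed

section \<open>Networks and their Dirichlet matroids\<close>

locale network =
  fixes V :: "'v set" and E :: "'v set set" and B :: "'v set"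
  assumes finite_V: "finite V"
    and edges: "e \<in> E \<Longrightarrow> e \<subseteq> V \<and> card e = 2"
    and connected: "x \<in> V \<Longrightarrow> y \<in> V \<Longrightarrow> (x, y) \<in> {(a, b). {a, b} \<in> E}\<^sup>*"
    and boundary: "B \<subset> V"
    and boundary_ge_2: "card B \<ge> 2"
    and boundary_nonadjacent: "i \<in> B \<Longrightarrow> j \<in> B \<Longrightarrow> {i, j} \<notin> E"

text \<open>
  Coordinates are indexed by \<^typ>\<open>'v option\<close>: \<^const>\<open>None\<close> is the extra index \<open>0\<close> and
  \<open>Some i\<close> is the coordinate of the interior vertex \<open>i\<close>. The edge vectors below have no
  coordinates at \<open>Some j\<close> for \<open>j\<close> outside \<open>V - B\<close>.
\<close>
abbreviation basis_vec :: "'v option \<Rightarrow> ('v option \<Rightarrow>\<^sub>0 real)" where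
  "basis_vec i \<equiv> Poly_Mapping.single i 1"

text \<open>
  For an edge between two interior vertices the vector is only determined up to sign, which
  corresponds to an orientation of the edge and does not affect linear independence; the choice
  operator picks one. For an edge with an end in \<open>B\<close> the vector is unique.
\<close>
definition edge_vec :: "'v set \<Rightarrow> ('v \<Rightarrow> real) \<Rightarrow> 'v set \<Rightarrow> ('v option \<Rightarrow>\<^sub>0 real)" where
  "edge_vec B u e = (SOME x. \<exists>i j. e = {i, j} \<and> i \<noteq> j \<and> i \<notin> B \<and>
     x = (if j \<in> B then basis_vec (Some i) - u j *\<^sub>R basis_vec None
                   else basis_vec (Some i) - basis_vec (Some j)))"

text \<open>In the ground set, \<^const>\<open>None\<close> is the element \<open>e\<^sub>0\<close> and \<open>Some e\<close> is the edge \<open>e\<close>.\<close>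
definition dirichlet_ground :: "'v set set \<Rightarrow> 'v set option set" where
  "dirichlet_ground E = insert None (Some ` E)"

definition dirichlet_vec :: "'v set \<Rightarrow> ('v \<Rightarrow> real) \<Rightarrow> 'v set option \<Rightarrow> ('v option \<Rightarrow>\<^sub>0 real)" where
  "dirichlet_vec B u a = (case a of None \<Rightarrow> basis_vec None | Some e \<Rightarrow> edge_vec B u e)"

definition dirichlet_indep ::
    "'v set set \<Rightarrow> 'v set \<Rightarrow> ('v \<Rightarrow> real) \<Rightarrow> 'v set option set \<Rightarrow> bool" where
  "dirichlet_indep E B u = vector_indep (dirichlet_ground E) (dirichlet_vec B u)"

lemma (in network) matroid_dirichlet: "matroid (dirichlet_ground E) (dirichlet_indep E B u)"
proof -
  have "E \<subseteq> Pow V" using edges by blast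
  then have "finite E" using finite_V finite_subset by blast
  then show ?thesis
    by (simp add: dirichlet_indep_def dirichlet_ground_def matroid_vector_indep)
qed

lemma edge_vec_spec:
  assumes "i \<noteq> j" "i \<notin> B"
  obtains i' j' where "{i, j} = {i', j'}" "i' \<notin> B"
    "edge_vec B u {i, j} = (if j' \<in> B then basis_vec (Some i') - u j' *\<^sub>R basis_vec None
                            else basis_vec (Some i') - basis_vec (Some j'))"
proof -
  define P where "P = (\<lambda>x. \<exists>i' j'. {i, j} = {i', j'} \<and> i' \<noteq> j' \<and> i' \<notin> B \<and>
     x = (if j' \<in> B then basis_vec (Some i') - u j' *\<^sub>R basis_vec None
                     else basis_vec (Some i') - basis_vec (Some j')))"
  have "\<exists>x. P x" unfolding P_def using assms by blast
  then have "P (SOME x. P x)" by (rule someI_ex)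
  then have "P (edge_vec B u {i, j})" by (simp only: edge_vec_def P_def)
  then obtain i' j' where "{i, j} = {i', j'}" "i' \<notin> B"
    "edge_vec B u {i, j} = (if j' \<in> B then basis_vec (Some i') - u j' *\<^sub>R basis_vec None
                            else basis_vec (Some i') - basis_vec (Some j'))"
    unfolding P_def by blast
  then show thesis by (rule that)
qed

lemma (in network) edge_vec_interior:
  assumes "{i, j} \<in> E" "i \<notin> B" "j \<notin> B"
  shows "edge_vec B u {i, j} \<in> {basis_vec (Some i) - basis_vec (Some j),
                                basis_vec (Some j) - basis_vec (Some i)}"
proof -
  have "i \<noteq> j" using edges[OF assms(1)] by auto
  then obtain i' j' where ij: "{i, j} = {i', j'}" and
    eq: "edge_vec B u {i, j} = (if j' \<in> B then basis_vec (Some i') - u j' *\<^sub>R basis_vec None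
                            else basis_vec (Some i') - basis_vec (Some j'))"
    using \<open>i \<notin> B\<close> by (rule edge_vec_spec)
  from ij consider "i' = i" "j' = j" | "i' = j" "j' = i" by (metis doubleton_eq_iff)
  then show ?thesis
    by cases (use assms in \<open>simp_all add: eq\<close>)
qed

lemma (in network) edge_vec_boundary:
  assumes "{i, j} \<in> E" "i \<notin> B" "j \<in> B"
  shows "edge_vec B u {i, j} = basis_vec (Some i) - u j *\<^sub>R basis_vec None"
proof -
  have "i \<noteq> j" using assms by auto
  then obtain i' j' where ij: "{i, j} = {i', j'}" "i' \<notin> B" and
    eq: "edge_vec B u {i, j} = (if j' \<in> B then basis_vec (Some i') - u j' *\<^sub>R basis_vec None
                            else basis_vec (Some i') - basis_vec (Some j'))"
    using \<open>i \<notin> B\<close> by (rule edge_vec_spec)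
  from ij \<open>j \<in> B\<close> have "i' = i" "j' = j" by (metis doubleton_eq_iff)+
  then show ?thesis using assms by (simp add: eq)
qed

end

theory Submission
  imports Defs
begin

text \<open>
  Let \<open>T R\<close> be the weighted sum of the spanning forests in which every tree contains exactly one
  element of \<open>R\<close>. A basis containing \<open>e\<^sub>0\<close> is \<open>e\<^sub>0\<close> together with such a forest for \<open>R = B\<close>. In a basis
  avoiding \<open>e\<^sub>0\<close> exactly one pair \<open>k, l\<close> of boundary nodes is connected, so it is such a forest for
  \<open>R = B - {k}\<close> and \<open>R = B - {l}\<close>. Hence the basis generating polynomial is
  \<open>x\<^sub>0 * T B + (\<Sum>k\<in>B. T (B - {k})) / 2\<close>. The ratio \<open>T (R - {k}) / T R\<close> is the effective
  conductance between \<open>k\<close> and \<open>R - {k}\<close>, that is, the sum of \<open>x e * \<bar>dh e\<bar>\<^sup>2\<close> over all edges, where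
  \<open>h\<close> is harmonic off \<open>R\<close> with boundary values \<open>1\<close> at \<open>k\<close> and \<open>0\<close> on the rest of \<open>R\<close>. It thus has positive
  imaginary part if all \<open>x e\<close> do, and \<open>T R \<noteq> 0\<close> follows from \<open>T V = 1\<close> by removing roots one at a time.
\<close>

section \<open>Parent maps\<close>

text \<open>
  A forest with root set \<open>R\<close> is encoded by the map from each vertex outside \<open>R\<close> to its parent.
\<close>

inductive leads :: "('v \<Rightarrow> 'v) \<Rightarrow> 'v set \<Rightarrow> 'v \<Rightarrow> 'v \<Rightarrow> bool" for p R where
  root: "r \<in> R \<Longrightarrow> leads p R r r"
| step: "v \<notin> R \<Longrightarrow> leads p R (p v) r \<Longrightarrow> leads p R v r"

lemma leads_root_iff: "v \<in> R \<Longrightarrow> leads p R v r \<longleftrightarrow> r = v"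
  by (auto intro: leads.root elim: leads.cases)

lemma leads_step_iff: "v \<notin> R \<Longrightarrow> leads p R v r \<longleftrightarrow> leads p R (p v) r"
  by (auto intro: leads.step elim: leads.cases)

lemma leads_unique: "leads p R v r \<Longrightarrow> leads p R v s \<Longrightarrow> s = r"
  by (induction rule: leads.induct) (auto simp: leads_root_iff leads_step_iff)

lemma leads_cong:
  assumes "\<And>v. v \<notin> R \<Longrightarrow> p v = q v"
  shows "leads p R v r \<longleftrightarrow> leads q R v r"
proof
  show "leads q R v r" if "leads p R v r"
    using that by induction (simp_all add: assms leads_root_iff leads_step_iff)
  show "leads p R v r" if "leads q R v r"
    using that by induction (simp_all add: assms[symmetric] leads_root_iff leads_step_iff)
qed

lemma leads_fun_upd: "leads (p(v := w)) (insert v R) a r \<longleftrightarrow> leads p (insert v R) a r"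
  by (rule leads_cong) auto

text \<open>A walk along \<open>p\<close> to a root of \<open>R\<close> either avoids
  \<open>v\<close>, or meets \<open>v\<close> once and goes on from \<open>p v\<close> without
  returning. Reading \<open>v\<close> as an extra root splits the walk at that point.\<close>

lemma leads_remove_root:
  assumes "v \<notin> R"
  shows "leads p R a r \<longleftrightarrow>
    r \<in> R \<and> (leads p (insert v R) a r \<or> leads p (insert v R) a v \<and> leads p (insert v R) (p v) r)"
    (is "_ \<longleftrightarrow> ?rhs a")
proof
  show "?rhs a" if "leads p R a r"
    using that
  proof induction
    case (step b r)
    then show ?case by (cases "b = v") (auto simp: leads_root_iff leads_step_iff)
  qed (auto intro: leads.root)
next
  have direct: "leads p R b r" if "leads p (insert v R) b r" "r \<in> R" for b
    using that by induction (auto simp: leads_root_iff leads_step_iff)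
  have via: "leads p R b r" if "leads p (insert v R) b v" "leads p R v r" for b
    using that
  proof (induction b v rule: leads.induct)
    case (step b s)
    then show ?case by (auto simp: leads_step_iff)
  qed simp
  assume a: "?rhs a"
  then have "r \<in> R" by simp
  from a consider "leads p (insert v R) a r" | "leads p (insert v R) a v" "leads p (insert v R) (p v) r"
    by blast
  then show "leads p R a r"
  proof cases
    case 1
    then show ?thesis using \<open>r \<in> R\<close> by (rule direct)
  next
    case 2
    from direct[OF 2(2) \<open>r \<in> R\<close>] show ?thesis
      by (intro via[OF 2(1)] leads.step[OF assms])
  qed
qed

text \<open>If the parent of \<open>v\<close> leads back to \<open>v\<close>, a walk that meets
  \<open>v\<close> circulates forever, so no walk ending in a root can meet
  \<open>v\<close>.\<close>

lemma leads_no_cycle: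
  assumes "leads p R a r" "v \<notin> R" "leads p (insert v R) (p v) v"
  shows "\<not> leads p (insert v R) a v"
  using assms
proof induction
  case (root r)
  then show ?case by (auto simp: leads_root_iff)
next
  case (step b r)
  then show ?case by (cases "b = v") (simp_all add: leads_step_iff)
qed

text \<open>Two vertices that are each other's parents trap every walk. This is the only kind of
  cycle to exclude when vertices are recovered from their parent edges.\<close>

lemma leads_no_2_cycle:
  assumes "leads p R a r" "v \<notin> R" "w \<notin> R" "p v = w" "p w = v"
  shows "a \<noteq> v \<and> a \<noteq> w"
  using assms by induction auto

section \<open>Weighted sums of rooted spanning forests\<close>

text \<open>Acyclicity is hidden in \<open>leads\<close>: being inductive, it relates a vertex whose
  walk runs into a cycle to no root at all.\<close>

definition forest_maps :: "'v set \<Rightarrow> 'v set \<Rightarrow> ('v \<Rightarrow> 'v) set" where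
  "forest_maps V R = {p \<in> (V - R) \<rightarrow>\<^sub>E V. \<forall>v\<in>V. \<exists>r\<in>R. leads p R v r}"

definition map_weight :: "'v set \<Rightarrow> ('v \<Rightarrow> 'v \<Rightarrow> complex) \<Rightarrow> 'v set \<Rightarrow> ('v \<Rightarrow> 'v) \<Rightarrow> complex" where
  "map_weight V c R p = (\<Prod>v\<in>V - R. c v (p v))"

definition forest_sum :: "'v set \<Rightarrow> ('v \<Rightarrow> 'v \<Rightarrow> complex) \<Rightarrow> 'v set \<Rightarrow> complex" where
  "forest_sum V c R = (\<Sum>p\<in>forest_maps V R. map_weight V c R p)"

text \<open>After division by \<open>forest_sum V c R\<close> this is, as a function of
  \<open>w\<close>, the electric potential with value 1 at \<open>k\<close> and 0 at the other
  roots.\<close>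

definition rooted_sum ::
    "'v set \<Rightarrow> ('v \<Rightarrow> 'v \<Rightarrow> complex) \<Rightarrow> 'v set \<Rightarrow> 'v \<Rightarrow> 'v \<Rightarrow> complex" where
  "rooted_sum V c R k w = (\<Sum>p\<in>forest_maps V R. of_bool (leads p R w k) * map_weight V c R p)"

lemma finite_forest_maps: "finite V \<Longrightarrow> finite (forest_maps V R)"
  unfolding forest_maps_def by (rule finite_subset[OF _ finite_PiE[of "V - R" "\<lambda>_. V"]]) auto

lemma forest_maps_leads_unique:
  assumes "p \<in> forest_maps V R" "v \<in> V"
  obtains r where "r \<in> R" "\<And>s. leads p R v s \<longleftrightarrow> s = r"
proof -
  obtain r where r: "r \<in> R" "leads p R v r" using assms by (auto simp: forest_maps_def)
  show thesis
  proof (rule that[OF r(1)])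
    show "leads p R v s \<longleftrightarrow> s = r" for s
      using r(2) leads_unique[OF r(2)] by blast
  qed
qed

text \<open>Cutting the edge from \<open>v\<close> to its parent turns \<open>v\<close> into a new root.\<close>
lemma bij_betw_forest_maps:
  fixes V R :: "'v set"
  assumes "v \<in> V" "v \<notin> R"
  shows "bij_betw (\<lambda>(w, q). q(v := w))
    {(w, q) \<in> V \<times> forest_maps V (insert v R). \<not> leads q (insert v R) w v} (forest_maps V R)"
    (is "bij_betw ?f ?D _")
proof -
  define f where "f = ?f"
  \<comment> \<open>The inverse forgets the parent of \<open>v\<close>; the reset to
    \<open>undefined\<close> makes the map extensional off the enlarged root set.\<close>
  define g where "g p = (p v, p(v := undefined))" for p :: "'v \<Rightarrow> 'v"
  have f: "f (w, q) = q(v := w)" for w q by (simp add: f_def)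
  have D: "V - R = insert v (V - insert v R)" using assms by auto
  have "\<forall>x\<in>?D. g (f x) = x"
  proof (clarsimp simp: f g_def)
    fix q w
    assume "q \<in> forest_maps V (insert v R)"
    then have "q v = undefined" by (auto simp: forest_maps_def PiE_def extensional_def)
    then show "q(v := undefined) = q" by (simp add: fun_upd_idem)
  qed
  moreover have "\<forall>p\<in>forest_maps V R. f (g p) = p"
    unfolding g_def f fun_upd_upd by (intro ballI fun_upd_triv)
  moreover have "f ` ?D \<subseteq> forest_maps V R"
  proof (clarsimp simp: f)
    fix w q
    assume w: "w \<in> V" "\<not> leads q (insert v R) w v" and q: "q \<in> forest_maps V (insert v R)"
    have ex: "\<exists>r\<in>insert v R. leads q (insert v R) a r" if "a \<in> V" for a
      using q that unfolding forest_maps_def by (elim CollectE conjE) (rule bspec)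
    have "\<exists>r\<in>R. leads (q(v := w)) R a r" if a: "a \<in> V" for a
    proof -
      obtain r where r: "r \<in> insert v R" "leads q (insert v R) a r"
        using ex[OF a] by blast
      obtain s where s: "s \<in> insert v R" "leads q (insert v R) w s"
        using ex[OF w(1)] by blast
      then have "s \<in> R" using w by auto
      show ?thesis
        unfolding leads_remove_root[OF assms(2)] leads_fun_upd fun_upd_same
        using r s \<open>s \<in> R\<close> by (cases "r = v") blast+
    qed
    moreover have "q(v := w) \<in> (V - R) \<rightarrow>\<^sub>E V"
      unfolding D by (rule PiE_fun_upd) (use q w in \<open>simp_all add: forest_maps_def\<close>)
    ultimately show "q(v := w) \<in> forest_maps V R"
      by (simp add: forest_maps_def)
  qed
  moreover have "g ` forest_maps V R \<subseteq> ?D"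
  proof (clarsimp simp: g_def)
    fix p
    assume p: "p \<in> forest_maps V R"
    have mem: "p \<in> (V - R) \<rightarrow>\<^sub>E V" and ex: "\<And>a. a \<in> V \<Longrightarrow> \<exists>r\<in>R. leads p R a r"
      using p by (auto simp: forest_maps_def)
    have "p v \<in> V" using mem assms by auto
    moreover have "p(v := undefined) \<in> forest_maps V (insert v R)"
    proof -
      have "p(v := undefined) \<in> (V - insert v R) \<rightarrow>\<^sub>E V"
        using mem by (auto simp: PiE_def extensional_def)
      moreover have "\<exists>r\<in>insert v R. leads p (insert v R) a r" if a: "a \<in> V" for a
      proof -
        obtain r where "leads p R a r" using ex[OF a] by blast
        then show ?thesis unfolding leads_remove_root[OF assms(2)] by blast
      qed
      ultimately show ?thesis by (simp add: forest_maps_def leads_fun_upd)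
    qed
    moreover have "\<not> leads p (insert v R) (p v) v"
    proof -
      obtain r where r: "leads p R (p v) r" using ex[OF \<open>p v \<in> V\<close>] by blast
      show ?thesis using leads_no_cycle[OF r assms(2)] by blast
    qed
    ultimately show "p v \<in> V \<and> p(v := undefined) \<in> forest_maps V (insert v R) \<and>
        \<not> leads (p(v := undefined)) (insert v R) (p v) v"
      by (simp add: leads_fun_upd)
  qed
  ultimately have "bij_betw f ?D (forest_maps V R)"
    by (rule bij_betw_byWitness)
  then show ?thesis by (simp only: f_def)
qed

text \<open>Cutting at \<open>v\<close> as a summation rule. The free factor \<open>g\<close> lets
  it serve both \<open>forest_sum\<close> (constant 1) and \<open>rooted_sum\<close> (an
  indicator).\<close>

lemma sum_forest_maps_split:
  assumes "finite V" "v \<in> V" "v \<notin> R"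
  shows "(\<Sum>p\<in>forest_maps V R. g p * map_weight V c R p) =
    (\<Sum>q\<in>forest_maps V (insert v R). map_weight V c (insert v R) q *
      (\<Sum>w\<in>V. c v w * (of_bool (\<not> leads q (insert v R) w v) * g (q(v := w)))))"
proof -
  let ?F = "forest_maps V (insert v R)"
  have D: "V - R = insert v (V - insert v R)" using assms by auto
  have weight: "map_weight V c R (q(v := w)) = c v w * map_weight V c (insert v R) q" for q w
  proof -
    have "map_weight V c R (q(v := w)) = c v w * (\<Prod>a\<in>V - insert v R. c a ((q(v := w)) a))"
      unfolding map_weight_def D by (subst prod.insert) (use assms in auto)
    also have "(\<Prod>a\<in>V - insert v R. c a ((q(v := w)) a)) = map_weight V c (insert v R) q"
      unfolding map_weight_def by (rule prod.cong) auto
    finally show ?thesis .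
  qed
  have "(\<Sum>p\<in>forest_maps V R. g p * map_weight V c R p) =
      (\<Sum>(w, q)\<in>{(w, q) \<in> V \<times> ?F. \<not> leads q (insert v R) w v}.
        g (q(v := w)) * map_weight V c R (q(v := w)))"
    by (subst sum.reindex_bij_betw[OF bij_betw_forest_maps[OF assms(2,3)], symmetric])
      (simp add: case_prod_unfold)
  also have "\<dots> = (\<Sum>(w, q)\<in>V \<times> ?F. of_bool (\<not> leads q (insert v R) w v) *
        (g (q(v := w)) * map_weight V c R (q(v := w))))"
    by (rule sum.mono_neutral_cong_left)
      (use assms finite_forest_maps in \<open>auto simp: case_prod_unfold\<close>)
  also have "\<dots> = (\<Sum>q\<in>?F. \<Sum>w\<in>V. of_bool (\<not> leads q (insert v R) w v) *
        (g (q(v := w)) * map_weight V c R (q(v := w))))"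
    by (subst sum.cartesian_product[symmetric], rule sum.swap)
  finally show ?thesis
    by (simp add: weight sum_distrib_left mult_ac)
qed

text \<open>Attaching the root \<open>v\<close> to \<open>w\<close> closes a cycle exactly if
  \<open>w\<close> lies in the tree of \<open>v\<close>; the difference removes these
  forests.\<close>

lemma forest_sum_remove_root:
  assumes "finite V" "v \<in> V" "v \<notin> R"
  shows "forest_sum V c R =
    (\<Sum>w\<in>V. c v w * (forest_sum V c (insert v R) - rooted_sum V c (insert v R) v w))"
proof -
  have "forest_sum V c R = (\<Sum>q\<in>forest_maps V (insert v R). map_weight V c (insert v R) q *
      (\<Sum>w\<in>V. c v w * of_bool (\<not> leads q (insert v R) w v)))"
    using sum_forest_maps_split[OF assms, of "\<lambda>_. 1" c] by (simp add: forest_sum_def)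
  also have "\<dots> = (\<Sum>w\<in>V. c v w * (\<Sum>q\<in>forest_maps V (insert v R).
      of_bool (\<not> leads q (insert v R) w v) * map_weight V c (insert v R) q))"
    unfolding sum_distrib_left by (subst sum.swap) (simp add: mult_ac)
  also have "\<dots> = (\<Sum>w\<in>V. c v w * (forest_sum V c (insert v R) - rooted_sum V c (insert v R) v w))"
    unfolding forest_sum_def rooted_sum_def sum_subtractf[symmetric]
    by (intro sum.cong arg_cong2[where f = "(*)"] refl) auto
  finally show ?thesis .
qed

text \<open>
  Expanding at \<open>v\<close> gives, for each forest with the extra root \<open>v\<close>, a double sum over pairs \<open>a, w\<close> of
  neighbours of \<open>v\<close> whose summand is antisymmetric in \<open>a\<close> and \<open>w\<close>.
\<close>
lemma rooted_sum_harmonic: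
  assumes "finite V" "v \<in> V" "v \<notin> R" "k \<in> R"
  shows "(\<Sum>a\<in>V. c v a * (rooted_sum V c R k v - rooted_sum V c R k a)) = 0"
proof -
  let ?R = "insert v R" and ?F = "forest_maps V (insert v R)"
  let ?L = "\<lambda>q a r. of_bool (leads q (insert v R) a r) :: complex"
  have "k \<noteq> v" using assms by auto
  \<comment> \<open>Once \<open>v\<close> is attached to \<open>w\<close>, the vertex
    \<open>a\<close> belongs to \<open>k\<close> if it did before, or if it was in the tree of
    \<open>v\<close> while \<open>w\<close> is in that of \<open>k\<close>. In the second case no
    cycle can close, so only the first carries the factor excluding one.\<close>
  have expand: "rooted_sum V c R k a = (\<Sum>q\<in>?F. map_weight V c ?R q *
      (\<Sum>w\<in>V. c v w * (?L q a k * (1 - ?L q w v) + ?L q a v * ?L q w k)))" if a: "a \<in> V" for a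
    unfolding rooted_sum_def sum_forest_maps_split[OF assms(1-3)]
  proof (intro sum.cong arg_cong2[where f = "(*)"] refl)
    fix q w assume q: "q \<in> ?F" and w: "w \<in> V"
    obtain r where "\<And>s. leads q ?R a s \<longleftrightarrow> s = r"
      using forest_maps_leads_unique[OF q a] by blast
    moreover obtain t where "\<And>s. leads q ?R w s \<longleftrightarrow> s = t"
      using forest_maps_leads_unique[OF q w] by blast
    ultimately show "of_bool (\<not> leads q ?R w v) * of_bool (leads (q(v := w)) R a k) =
        ?L q a k * (1 - ?L q w v) + ?L q a v * ?L q w k"
      using \<open>k \<in> R\<close> \<open>k \<noteq> v\<close> by (auto simp: leads_remove_root[OF assms(3)] leads_fun_upd)
  qed
  have at_v: "?L q v k = 0" "?L q v v = 1" for q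
    using \<open>k \<noteq> v\<close> by (simp_all add: leads_root_iff)
  have "(\<Sum>a\<in>V. c v a * (rooted_sum V c R k v - rooted_sum V c R k a)) =
      (\<Sum>a\<in>V. c v a * (\<Sum>q\<in>?F. map_weight V c ?R q *
        (\<Sum>w\<in>V. c v w * (?L q w k - ?L q a k * (1 - ?L q w v) - ?L q a v * ?L q w k))))"
  proof (intro sum.cong arg_cong2[where f = "(*)"] refl)
    fix a assume "a \<in> V"
    show "rooted_sum V c R k v - rooted_sum V c R k a = (\<Sum>q\<in>?F. map_weight V c ?R q *
        (\<Sum>w\<in>V. c v w * (?L q w k - ?L q a k * (1 - ?L q w v) - ?L q a v * ?L q w k)))"
      unfolding expand[OF assms(2)] expand[OF \<open>a \<in> V\<close>] at_v
        sum_subtractf[symmetric] right_diff_distrib[symmetric]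
      by (simp only: mult_zero_left mult_1 add_0 diff_diff_eq)
  qed
  also have "\<dots> = (\<Sum>q\<in>?F. map_weight V c ?R q *
      (\<Sum>a\<in>V. \<Sum>w\<in>V. c v a * c v w * (?L q w k - ?L q a k * (1 - ?L q w v) - ?L q a v * ?L q w k)))"
    unfolding sum_distrib_left by (subst sum.swap) (simp add: mult_ac)
  also have "\<dots> = 0"
  proof (intro sum.neutral ballI)
    fix q
    let ?f = "\<lambda>a w. c v a * c v w * ?L q w k"
    let ?g = "\<lambda>a w. c v a * c v w * (?L q a k * ?L q w v)"
    have "(\<Sum>a\<in>V. \<Sum>w\<in>V. c v a * c v w *
          (?L q w k - ?L q a k * (1 - ?L q w v) - ?L q a v * ?L q w k)) =
        (\<Sum>a\<in>V. \<Sum>w\<in>V. ?f a w) - (\<Sum>a\<in>V. \<Sum>w\<in>V. ?f w a)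
        + (\<Sum>a\<in>V. \<Sum>w\<in>V. ?g a w) - (\<Sum>a\<in>V. \<Sum>w\<in>V. ?g w a)"
      unfolding sum_subtractf[symmetric] sum.distrib[symmetric]
      by (intro sum.cong refl) (simp add: algebra_simps)
    also have "\<dots> = 0"
      by (subst (2) sum.swap, subst (4) sum.swap) simp
    finally show "map_weight V c ?R q * (\<Sum>a\<in>V. \<Sum>w\<in>V. c v a * c v w *
          (?L q w k - ?L q a k * (1 - ?L q w v) - ?L q a v * ?L q w k)) = 0"
      by simp
  qed
  finally show ?thesis .
qed

section \<open>Dirichlet energy and effective conductance\<close>

text \<open>A discrete Green identity: exchanging \<open>a\<close> and \<open>w\<close> and adding
  pairs up the terms to \<open>\<bar>h a - h w\<bar>\<close> squared. The conjugate makes these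
  factors real and nonnegative although \<open>h\<close> is complex.\<close>

lemma dirichlet_energy:
  fixes c :: "'v \<Rightarrow> 'v \<Rightarrow> complex"
  assumes "\<And>a w. a \<in> V \<Longrightarrow> w \<in> V \<Longrightarrow> c a w = c w a"
  shows "2 * (\<Sum>a\<in>V. cnj (h a) * (\<Sum>w\<in>V. c a w * (h a - h w))) =
    (\<Sum>a\<in>V. \<Sum>w\<in>V. c a w * of_real ((cmod (h a - h w))\<^sup>2))"
proof -
  let ?f = "\<lambda>a w. c a w * (cnj (h a) * (h a - h w))"
  have "(\<Sum>a\<in>V. cnj (h a) * (\<Sum>w\<in>V. c a w * (h a - h w))) = (\<Sum>a\<in>V. \<Sum>w\<in>V. ?f a w)"
    by (simp add: sum_distrib_left mult_ac)
  moreover have "(\<Sum>a\<in>V. \<Sum>w\<in>V. ?f a w) = (\<Sum>a\<in>V. \<Sum>w\<in>V. ?f w a)"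
    by (rule sum.swap)
  ultimately have "2 * (\<Sum>a\<in>V. cnj (h a) * (\<Sum>w\<in>V. c a w * (h a - h w))) =
      (\<Sum>a\<in>V. \<Sum>w\<in>V. ?f a w + ?f w a)"
    by (simp add: sum.distrib)
  also have "\<dots> = (\<Sum>a\<in>V. \<Sum>w\<in>V. c a w * of_real ((cmod (h a - h w))\<^sup>2))"
  proof (intro sum.cong refl)
    fix a w assume "a \<in> V" "w \<in> V"
    then have "?f w a = c a w * (cnj (h w) * (h w - h a))" by (simp add: assms)
    then show "?f a w + ?f w a = c a w * of_real ((cmod (h a - h w))\<^sup>2)"
      unfolding complex_norm_square by (simp add: algebra_simps)
  qed
  finally show ?thesis .
qed

text \<open>The ratio is the current leaving \<open>v\<close> under the potential \<open>h\<close>,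
  hence the Dirichlet energy of \<open>h\<close>. The energy has positive imaginary part since
  \<open>h\<close> is not constant on a graph connected by weights of positive imaginary
  part.\<close>

lemma forest_sum_ratio:
  fixes c :: "'v \<Rightarrow> 'v \<Rightarrow> complex"
  assumes "finite V" and sym: "\<And>a w. a \<in> V \<Longrightarrow> w \<in> V \<Longrightarrow> c a w = c w a"
    and nonneg: "\<And>a w. a \<in> V \<Longrightarrow> w \<in> V \<Longrightarrow> Im (c a w) \<ge> 0"
    and conn: "\<And>a w. a \<in> V \<Longrightarrow> w \<in> V \<Longrightarrow> (a, w) \<in> {(a, w). a \<in> V \<and> w \<in> V \<and> Im (c a w) > 0}\<^sup>*"
    and R: "R \<subseteq> V" "R \<noteq> {}" and v: "v \<in> V" "v \<notin> R"
    and nz: "forest_sum V c (insert v R) \<noteq> 0"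
  shows "Im (forest_sum V c R / forest_sum V c (insert v R)) > 0"
proof -
  let ?T = "forest_sum V c (insert v R)"
  define h where "h w = rooted_sum V c (insert v R) v w / ?T" for w
  define flow where "flow a = (\<Sum>w\<in>V. c a w * (h a - h w))" for a
  have hv: "h v = 1"
    using nz by (simp add: h_def rooted_sum_def forest_sum_def leads_root_iff)
  have hR: "h r = 0" if "r \<in> R" for r
    using that v by (auto simp: h_def rooted_sum_def leads_root_iff)
  have flow0: "flow a = 0" if "a \<in> V" "a \<notin> insert v R" for a
  proof -
    have "flow a = (\<Sum>w\<in>V. c a w * (rooted_sum V c (insert v R) v a - rooted_sum V c (insert v R) v w)) / ?T"
      unfolding flow_def h_def sum_divide_distrib diff_divide_distrib[symmetric] times_divide_eq_right ..
    then show ?thesis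
      using rooted_sum_harmonic[OF \<open>finite V\<close> that, of v c] by simp
  qed
  have "forest_sum V c R / ?T = flow v"
    using nz unfolding forest_sum_remove_root[OF \<open>finite V\<close> v] flow_def hv sum_divide_distrib
    by (intro sum.cong refl) (simp add: h_def field_simps)
  \<comment> \<open>Only \<open>a = v\<close> contributes: \<open>h\<close> vanishes on
    \<open>R\<close>, and \<open>flow\<close> vanishes off \<open>insert v R\<close> by
    harmonicity.\<close>
  also have "flow v = (\<Sum>a\<in>V. cnj (h a) * flow a)"
  proof -
    have "(\<Sum>a\<in>V - {v}. cnj (h a) * flow a) = 0"
      using hR flow0 by (intro sum.neutral) auto
    then show ?thesis
      using \<open>finite V\<close> v by (subst sum.remove[where x = v]) (auto simp: hv)
  qed
  finally have "2 * (forest_sum V c R / ?T) =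
      (\<Sum>a\<in>V. \<Sum>w\<in>V. c a w * of_real ((cmod (h a - h w))\<^sup>2))"
    using dirichlet_energy[of V c h, OF sym] unfolding flow_def by simp
  from arg_cong[OF this, of Im] have "2 * Im (forest_sum V c R / ?T) =
      Im (\<Sum>a\<in>V. \<Sum>w\<in>V. c a w * of_real ((cmod (h a - h w))\<^sup>2))"
    by (simp only: mult_2 plus_complex.sel)
  also have "\<dots> = (\<Sum>a\<in>V. \<Sum>w\<in>V. Im (c a w) * (cmod (h a - h w))\<^sup>2)"
    by simp
  also have "\<dots> > 0"
  proof -
    obtain r where r: "r \<in> R" using R by blast
    \<comment> \<open>Otherwise \<open>h\<close> would be constant along a path from
      \<open>v\<close> to \<open>r\<close>, where it takes the values 1 and 0.\<close>
    have "\<exists>a w. a \<in> V \<and> w \<in> V \<and> Im (c a w) > 0 \<and> h a \<noteq> h w"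
    proof (rule ccontr)
      assume neg: "\<not> ?thesis"
      have "(v, r) \<in> {(a, w). a \<in> V \<and> w \<in> V \<and> Im (c a w) > 0}\<^sup>*"
        using conn v r R by blast
      then have "h r = h v"
        by induction (use neg in auto)
      then show False using hv hR r by simp
    qed
    then obtain a w where aw: "a \<in> V" "w \<in> V" "Im (c a w) > 0" "h a \<noteq> h w" by blast
    have "(\<Sum>w\<in>V. Im (c a w) * (cmod (h a - h w))\<^sup>2) > 0"
      using aw \<open>finite V\<close> nonneg by (intro sum_pos2[of _ w]) auto
    then show ?thesis
      by (rule sum_pos2[of V a, OF \<open>finite V\<close> \<open>a \<in> V\<close>]) (simp add: nonneg sum_nonneg)
  qed
  finally show ?thesis by simp
qed

text \<open>Induction downwards from \<open>R = V\<close>, where the sum is the empty product 1.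
  Removing a root multiplies it by a number of positive imaginary part, which is not 0.\<close>

lemma forest_sum_nonzero:
  fixes c :: "'v \<Rightarrow> 'v \<Rightarrow> complex"
  assumes "finite V" and sym: "\<And>a w. a \<in> V \<Longrightarrow> w \<in> V \<Longrightarrow> c a w = c w a"
    and nonneg: "\<And>a w. a \<in> V \<Longrightarrow> w \<in> V \<Longrightarrow> Im (c a w) \<ge> 0"
    and conn: "\<And>a w. a \<in> V \<Longrightarrow> w \<in> V \<Longrightarrow> (a, w) \<in> {(a, w). a \<in> V \<and> w \<in> V \<and> Im (c a w) > 0}\<^sup>*"
    and R: "R \<subseteq> V" "R \<noteq> {}"
  shows "forest_sum V c R \<noteq> 0"
  using R
proof (induction "card (V - R)" arbitrary: R rule: less_induct)
  case less
  show ?case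
  proof (cases "R = V")
    case True
    then have "forest_maps V R = {\<lambda>_. undefined}"
      by (auto simp: forest_maps_def intro: leads.root)
    then show ?thesis
      using True by (simp add: forest_sum_def map_weight_def)
  next
    case False
    then obtain v where v: "v \<in> V" "v \<notin> R" using less by blast
    have "card (V - insert v R) < card (V - R)"
      using v \<open>finite V\<close> by (intro psubset_card_mono) auto
    then have "forest_sum V c (insert v R) \<noteq> 0"
      using less v by auto
    from forest_sum_ratio[OF \<open>finite V\<close> sym nonneg conn less.prems v this]
    show ?thesis by auto
  qed
qed

section \<open>Spanning forests as edge sets\<close>

abbreviation adj :: "'v set set \<Rightarrow> ('v \<times> 'v) set" where
  "adj Y \<equiv> {(a, b). {a, b} \<in> Y}"

lemma adj_rtrancl_sym: "(a, b) \<in> (adj Y)\<^sup>* \<Longrightarrow> (b, a) \<in> (adj Y)\<^sup>*"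
  by (rule symD[OF sym_rtrancl]) (auto simp: sym_def insert_commute)

text \<open>With exactly \<open>card (V - R)\<close> edges, connectedness to \<open>R\<close> implies acyclicity.\<close>
definition spanning_forests :: "'v set \<Rightarrow> 'v set set \<Rightarrow> 'v set \<Rightarrow> 'v set set set" where
  "spanning_forests V E R =
    {Y. Y \<subseteq> E \<and> card Y = card (V - R) \<and> (\<forall>v\<in>V. \<exists>r\<in>R. (v, r) \<in> (adj Y)\<^sup>*)}"

definition map_edges :: "'v set \<Rightarrow> 'v set \<Rightarrow> ('v \<Rightarrow> 'v) \<Rightarrow> 'v set set" where
  "map_edges V R p = (\<lambda>v. {v, p v}) ` (V - R)"

text \<open>Distinct vertices sharing a parent edge would be each other's parents.\<close>

lemma inj_on_parent_edge:
  assumes "p \<in> forest_maps V R"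
  shows "inj_on (\<lambda>v. {v, p v}) (V - R)"
proof (rule inj_onI, rule ccontr)
  fix v w
  assume vw: "v \<in> V - R" "w \<in> V - R" "{v, p v} = {w, p w}" "v \<noteq> w"
  then have "p v = w" "p w = v" by (auto simp: doubleton_eq_iff)
  moreover obtain r where "leads p R v r"
    using assms vw by (auto simp: forest_maps_def)
  ultimately show False
    using leads_no_2_cycle[of p R v r v w] vw by auto
qed

text \<open>Breadth-first search: \<open>d\<close> is the distance to \<open>R\<close>, and every
  vertex outside \<open>R\<close> takes a strictly nearer neighbour as its parent, so walks end in
  \<open>R\<close>.\<close>

lemma exists_forest_map:
  assumes conn: "\<And>v. v \<in> V \<Longrightarrow> \<exists>r\<in>R. (v, r) \<in> (adj Y)\<^sup>*" and "\<Union>Y \<subseteq> V"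
  obtains p where "p \<in> forest_maps V R" "map_edges V R p \<subseteq> Y"
proof -
  define d where "d v = (LEAST n. \<exists>r\<in>R. (v, r) \<in> (adj Y) ^^ n)" for v
  have "\<exists>w\<in>V. {v, w} \<in> Y \<and> d w < d v" if v: "v \<in> V - R" for v
  proof -
    have "\<exists>n. \<exists>r\<in>R. (v, r) \<in> (adj Y) ^^ n"
      using conn v rtrancl_imp_relpow by (metis DiffD1)
    then obtain r where r: "r \<in> R" "(v, r) \<in> (adj Y) ^^ d v"
      unfolding d_def using LeastI_ex[of "\<lambda>n. \<exists>r\<in>R. (v, r) \<in> (adj Y) ^^ n"] by blast
    moreover from r v have "d v \<noteq> 0" by (intro notI) auto
    then obtain n where n: "d v = Suc n" by (metis not0_implies_Suc)
    ultimately obtain w where w: "(v, w) \<in> adj Y" "(w, r) \<in> (adj Y) ^^ n"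
      by (metis relpow_Suc_D2)
    have "d w \<le> n"
      unfolding d_def using w r by (intro Least_le) auto
    moreover have "w \<in> V" using w \<open>\<Union>Y \<subseteq> V\<close> by auto
    ultimately show ?thesis using w n by auto
  qed
  then obtain f where f: "\<And>v. v \<in> V - R \<Longrightarrow> f v \<in> V \<and> {v, f v} \<in> Y \<and> d (f v) < d v"
    by metis
  define p where "p = restrict f (V - R)"
  have "\<exists>r\<in>R. leads p R v r" if "v \<in> V" for v
    using that
  proof (induction "d v" arbitrary: v rule: less_induct)
    case less
    show ?case
    proof (cases "v \<in> R")
      case True
      then show ?thesis by (auto intro: leads.root)
    next
      case False
      then show ?thesis
        using less f[of v] by (auto simp: leads_step_iff p_def)
    qed
  qed
  then have "p \<in> forest_maps V R"
    using f by (auto simp: forest_maps_def p_def)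
  moreover have "map_edges V R p \<subseteq> Y"
    using f by (auto simp: map_edges_def p_def)
  ultimately show thesis by (rule that)
qed

lemma card_connected_edges_ge:
  assumes "\<And>v. v \<in> V \<Longrightarrow> \<exists>r\<in>R. (v, r) \<in> (adj Y)\<^sup>*" "\<Union>Y \<subseteq> V" "finite Y"
  shows "card (V - R) \<le> card Y"
proof -
  obtain p where p: "p \<in> forest_maps V R" "map_edges V R p \<subseteq> Y"
    using exists_forest_map[OF assms(1,2)] .
  then have "card (V - R) = card (map_edges V R p)"
    by (simp add: map_edges_def card_image inj_on_parent_edge)
  also have "\<dots> \<le> card Y" using p assms by (intro card_mono)
  finally show ?thesis .
qed

text \<open>A forest has only one orientation towards its roots, which gives injectivity. For
  surjectivity, a breadth-first map inside \<open>Y\<close> already uses \<open>card (V - R)\<close>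
  edges, so it uses all of \<open>Y\<close>.\<close>

lemma bij_betw_map_edges:
  assumes "finite V" "\<Union>E \<subseteq> V"
  shows "bij_betw (map_edges V R) {p \<in> forest_maps V R. map_edges V R p \<subseteq> E}
    (spanning_forests V E R)"
  unfolding bij_betw_def
proof
  show "inj_on (map_edges V R) {p \<in> forest_maps V R. map_edges V R p \<subseteq> E}"
  proof (rule inj_onI)
    fix p q
    assume "p \<in> {p \<in> forest_maps V R. map_edges V R p \<subseteq> E}"
      and "q \<in> {p \<in> forest_maps V R. map_edges V R p \<subseteq> E}"
      and eq: "map_edges V R p = map_edges V R q"
    then have p: "p \<in> forest_maps V R" and q: "q \<in> forest_maps V R" by auto
    have agree: "a \<in> V - R \<Longrightarrow> p a = q a" if "leads p R a r" for a r
      using that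
    proof (induction rule: leads.induct)
      case (step a r)
      have "{a, p a} \<in> map_edges V R q" using step eq by (auto simp: map_edges_def)
      then obtain b where b: "b \<in> V - R" "{a, p a} = {b, q b}"
        by (auto simp: map_edges_def)
      show ?case
      proof (rule ccontr)
        \<comment> \<open>Then \<open>q\<close> orients the edge the other way, and the induction
          hypothesis at \<open>p a\<close> turns this into a 2-cycle of \<open>p\<close>.\<close>
        assume "p a \<noteq> q a"
        with b have "b = p a" "q (p a) = a" by (auto simp: doubleton_eq_iff)
        with b step have "p (p a) = a" "p a \<notin> R" by auto
        with step leads_no_2_cycle[of p R "p a" r a "p a"] show False by auto
      qed
    qed auto
    have "p a = q a" if "a \<in> V - R" for a
      using agree that p by (auto simp: forest_maps_def)
    then show "p = q"
      using p q unfolding forest_maps_def by (auto intro: PiE_ext)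
  qed
  show "map_edges V R ` {p \<in> forest_maps V R. map_edges V R p \<subseteq> E} = spanning_forests V E R"
  proof (intro equalityI subsetI)
    fix Y
    assume "Y \<in> map_edges V R ` {p \<in> forest_maps V R. map_edges V R p \<subseteq> E}"
    then obtain p where p: "p \<in> forest_maps V R" and Y: "Y = map_edges V R p" "Y \<subseteq> E" by auto
    have "a \<in> V \<Longrightarrow> (a, r) \<in> (adj Y)\<^sup>*" if "leads p R a r" for a r
      using that
    proof (induction rule: leads.induct)
      case (step a r)
      then have "(a, p a) \<in> adj Y" by (auto simp: Y map_edges_def)
      moreover have "p a \<in> V" using p step by (auto simp: forest_maps_def)
      ultimately show ?case using step by (meson converse_rtrancl_into_rtrancl)
    qed simp
    moreover have "card Y = card (V - R)"
      using p by (simp add: Y map_edges_def card_image inj_on_parent_edge)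
    ultimately show "Y \<in> spanning_forests V E R"
      using p Y unfolding spanning_forests_def forest_maps_def by blast
  next
    fix Y
    assume Y: "Y \<in> spanning_forests V E R"
    then have "\<Union>Y \<subseteq> V" using assms by (auto simp: spanning_forests_def)
    then obtain p where p: "p \<in> forest_maps V R" "map_edges V R p \<subseteq> Y"
      using Y exists_forest_map[of V R Y] unfolding spanning_forests_def by blast
    moreover have "finite Y"
      using \<open>\<Union>Y \<subseteq> V\<close> \<open>finite V\<close> by (meson finite_UnionD finite_subset)
    moreover have "card Y \<le> card (map_edges V R p)"
      using p Y by (simp add: spanning_forests_def map_edges_def card_image inj_on_parent_edge)
    ultimately have "map_edges V R p = Y" by (metis card_seteq)
    then show "Y \<in> map_edges V R ` {p \<in> forest_maps V R. map_edges V R p \<subseteq> E}"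
      using p Y by (auto simp: spanning_forests_def)
  qed
qed

text \<open>Weight 0 on non-adjacent pairs lets \<open>forest_maps\<close> ignore the edge set: a
  map using a non-edge contributes nothing.\<close>

definition conductance :: "'v set set \<Rightarrow> ('v set \<Rightarrow> complex) \<Rightarrow> 'v \<Rightarrow> 'v \<Rightarrow> complex" where
  "conductance E x a b = (if {a, b} \<in> E then x {a, b} else 0)"

lemma forest_sum_conductance:
  assumes "finite V" "\<Union>E \<subseteq> V"
  shows "forest_sum V (conductance E x) R = (\<Sum>Y\<in>spanning_forests V E R. \<Prod>e\<in>Y. x e)"
proof -
  let ?F = "{p \<in> forest_maps V R. map_edges V R p \<subseteq> E}"
  have "forest_sum V (conductance E x) R = (\<Sum>p\<in>?F. map_weight V (conductance E x) R p)"
    unfolding forest_sum_def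
  proof (intro sum.mono_neutral_right ballI)
    fix p
    assume "p \<in> forest_maps V R - ?F"
    then obtain v where "v \<in> V - R" "{v, p v} \<notin> E" by (auto simp: map_edges_def)
    then show "map_weight V (conductance E x) R p = 0"
      using \<open>finite V\<close> unfolding map_weight_def
      by (intro prod_zero) (auto simp: conductance_def)
  qed (use assms finite_forest_maps in auto)
  also have "\<dots> = (\<Sum>p\<in>?F. \<Prod>e\<in>map_edges V R p. x e)"
  proof (intro sum.cong refl)
    fix p
    assume p: "p \<in> ?F"
    then have "(\<Prod>e\<in>map_edges V R p. x e) = (\<Prod>v\<in>V - R. x {v, p v})"
      unfolding map_edges_def by (subst prod.reindex) (auto simp: inj_on_parent_edge)
    also have "\<dots> = map_weight V (conductance E x) R p"
      using p unfolding map_weight_def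
      by (intro prod.cong refl) (auto simp: conductance_def map_edges_def)
    finally show "map_weight V (conductance E x) R p = (\<Prod>e\<in>map_edges V R p. x e)" by simp
  qed
  also have "\<dots> = (\<Sum>Y\<in>spanning_forests V E R. \<Prod>e\<in>Y. x e)"
    by (rule sum.reindex_bij_betw[OF bij_betw_map_edges[OF assms]])
  finally show ?thesis .
qed

section \<open>Bases of the Dirichlet matroid\<close>

text \<open>A spanning family with as many members as the dimension has neither repetitions nor
  dependences. Recognising bases thus reduces to counting and spanning.\<close>

lemma bases_vector_indep:
  fixes w :: "'a \<Rightarrow> 'b::real_vector"
  assumes "finite S" and D: "independent D" "finite D" and span: "w ` S \<subseteq> span D" "D \<subseteq> span (w ` S)"
  shows "bases (vector_indep S w) = {X. X \<subseteq> S \<and> card X = card D \<and> D \<subseteq> span (w ` X)}"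
proof (intro equalityI subsetI)
  fix X
  assume "X \<in> bases (vector_indep S w)"
  then have X: "X \<subseteq> S" "inj_on w X" "independent (w ` X)"
    and max: "\<And>Y. vector_indep S w Y \<Longrightarrow> X \<subseteq> Y \<Longrightarrow> Y = X"
    by (auto simp: bases_def vector_indep_def)
  have "w s \<in> span (w ` X)" if "s \<in> S" for s
  proof (rule ccontr)
    assume *: "w s \<notin> span (w ` X)"
    then have "w s \<notin> w ` X" using span_base by blast
    moreover from this have "s \<notin> X" by blast
    moreover have "independent (insert (w s) (w ` X))"
      using X * by (simp add: independent_insert)
    ultimately have "vector_indep S w (insert s X)"
      using X \<open>s \<in> S\<close> by (auto simp: vector_indep_def)
    with max \<open>s \<notin> X\<close> show False by blast
  qed
  then have "w ` S \<subseteq> span (w ` X)" by blast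
  then have "span (w ` S) \<subseteq> span (w ` X)" by (simp add: span_minimal)
  with span have sub: "D \<subseteq> span (w ` X)" by blast
  have "finite X" using X \<open>finite S\<close> finite_subset by blast
  have "card (w ` X) \<le> card D"
    using independent_span_bound[OF D(2) X(3)] X span by blast
  moreover have "card D \<le> card (w ` X)"
    using independent_span_bound[OF _ D(1) sub] \<open>finite X\<close> by blast
  ultimately show "X \<in> {X. X \<subseteq> S \<and> card X = card D \<and> D \<subseteq> span (w ` X)}"
    using X sub by (simp add: card_image)
next
  fix X
  assume "X \<in> {X. X \<subseteq> S \<and> card X = card D \<and> D \<subseteq> span (w ` X)}"
  then have X: "X \<subseteq> S" "card X = card D" "D \<subseteq> span (w ` X)" by auto
  have "finite X" using X \<open>finite S\<close> finite_subset by blast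
  obtain C where C: "C \<subseteq> w ` X" "independent C" "w ` X \<subseteq> span C"
    using maximal_independent_subset .
  have "finite C" using C \<open>finite X\<close> finite_subset by blast
  have "span (w ` X) \<subseteq> span C" using C by (simp add: span_minimal)
  then have "card D \<le> card C"
    using independent_span_bound[OF \<open>finite C\<close> D(1)] X by blast
  moreover have "card C \<le> card (w ` X)" using C \<open>finite X\<close> by (simp add: card_mono)
  moreover have "card (w ` X) \<le> card X" using \<open>finite X\<close> by (rule card_image_le)
  ultimately have "card C = card (w ` X)" "card (w ` X) = card X" using X by auto
  then have "C = w ` X" "inj_on w X"
    using C \<open>finite X\<close> by (auto simp: card_subset_eq eq_card_imp_inj_on)
  then have "vector_indep S w X" using X C by (simp add: vector_indep_def)
  moreover have "Y = X" if Y: "vector_indep S w Y" "X \<subseteq> Y" for Y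
  proof -
    have "w ` Y \<subseteq> span D" using Y span unfolding vector_indep_def by blast
    then have "card (w ` Y) \<le> card D"
      using Y independent_span_bound[OF D(2)] by (auto simp: vector_indep_def)
    then have "card Y \<le> card X"
      using X Y by (simp add: vector_indep_def card_image)
    moreover have "finite Y"
      using Y \<open>finite S\<close> finite_subset by (auto simp: vector_indep_def)
    ultimately show "Y = X" using Y card_seteq by metis
  qed
  ultimately show "X \<in> bases (vector_indep S w)" by (simp add: bases_def)
qed

section \<open>Coordinates and linear functionals\<close>

lemma lookup_scaleR: "Poly_Mapping.lookup (r *\<^sub>R z) i = r * Poly_Mapping.lookup z i"
proof -
  have "finite {i. r *\<^sub>R Poly_Mapping.lookup z i \<noteq> 0}"
    by (rule finite_subset[OF _ finite_lookup[of z]]) auto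
  then show ?thesis by (simp add: scaleR_poly_mapping_def)
qed

lemma linear_lookup: "linear (\<lambda>z::'k \<Rightarrow>\<^sub>0 real. Poly_Mapping.lookup z i)"
  by (rule linearI) (simp_all add: lookup_add lookup_scaleR)

text \<open>The standard basis of the ambient space of the Dirichlet matroid; the type also has
  coordinates for vertices that are not interior.\<close>

definition frame :: "'v set \<Rightarrow> 'v set \<Rightarrow> ('v option \<Rightarrow>\<^sub>0 real) set" where
  "frame V B = basis_vec ` insert None (Some ` (V - B))"

lemma inj_basis_vec: "inj basis_vec"
  by (rule injI) (metis lookup_single_eq lookup_single_not_eq zero_neq_one)

lemma card_frame: "finite V \<Longrightarrow> card (frame V B) = Suc (card (V - B))"
  unfolding frame_def
  by (subst card_image[OF inj_on_subset[OF inj_basis_vec subset_UNIV]]) (simp add: card_image)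

lemma independent_frame: "independent (frame V B)"
proof -
  have "basis_vec i \<notin> span (frame V B - {basis_vec i})" for i
  proof
    assume "basis_vec i \<in> span (frame V B - {basis_vec i})"
    then have "Poly_Mapping.lookup (basis_vec i) i = 0"
      by (rule linear_eq_0_on_span[OF linear_lookup, rotated])
        (auto simp: frame_def lookup_single when_def)
    then show False by simp
  qed
  moreover have "\<exists>i. a = basis_vec i" if "a \<in> frame V B" for a
    using that by (auto simp only: frame_def)
  ultimately show ?thesis unfolding dependent_def by blast
qed

text \<open>Placing each boundary node \<open>v\<close> at \<open>u v\<close> on the axis of
  \<open>None\<close> makes every edge vector, up to sign, a difference of two vertex
  vectors.\<close>

definition vertex_vec :: "'v set \<Rightarrow> ('v \<Rightarrow> real) \<Rightarrow> 'v \<Rightarrow> ('v option \<Rightarrow>\<^sub>0 real)" where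
  "vertex_vec B u v = (if v \<in> B then u v *\<^sub>R basis_vec None else basis_vec (Some v))"

text \<open>
  The linear functional that, for \<open>f\<close> equal to \<open>t\<close> times \<open>u\<close> on \<open>B\<close>, sends the vector of an edge to
  the difference of \<open>f\<close> along it.
\<close>
definition potential ::
    "'v set \<Rightarrow> 'v set \<Rightarrow> ('v \<Rightarrow> real) \<Rightarrow> real \<Rightarrow> ('v option \<Rightarrow>\<^sub>0 real) \<Rightarrow> real" where
  "potential V B f t z =
    t * Poly_Mapping.lookup z None + (\<Sum>i\<in>V - B. f i * Poly_Mapping.lookup z (Some i))"

lemma linear_potential: "linear (potential V B f t)"
  unfolding potential_def
  by (rule linearI)
    (simp_all add: lookup_add lookup_scaleR distrib_left sum.distrib sum_distrib_left mult_ac)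

lemma potential_None: "potential V B f t (basis_vec None) = t"
  by (simp add: potential_def lookup_single when_def)

lemma potential_Some: "finite V \<Longrightarrow> i \<in> V - B \<Longrightarrow> potential V B f t (basis_vec (Some i)) = f i"
  by (simp add: potential_def lookup_single when_def if_distrib[of "(*) _"] cong: if_cong)

lemma potential_vertex_vec:
  assumes "finite V" "v \<in> V" "\<And>b. b \<in> B \<Longrightarrow> f b = u b * t"
  shows "potential V B f t (vertex_vec B u v) = f v"
  using assms
  by (auto simp: vertex_vec_def linear_cmul[OF linear_potential] potential_None potential_Some)

section \<open>Spanning sets of edge vectors\<close>

context network
begin

lemma finite_B: "finite B"
  using boundary finite_V finite_subset by blast

lemma B_Diff_singleton_nonempty: "B - {k} \<noteq> {}"
proof
  assume "B - {k} = {}"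
  then have "card B \<le> card {k}" by (intro card_mono) auto
  then show False using boundary_ge_2 by simp
qed

lemma Union_E: "\<Union>E \<subseteq> V"
  using edges by blast

lemma finite_E: "finite E"
  using Union_E finite_V by (meson finite_UnionD finite_subset)

lemma finite_dirichlet_ground: "finite (dirichlet_ground E)"
  using finite_E by (simp add: dirichlet_ground_def)

lemma edgeE:
  assumes "e \<in> E"
  obtains i j where "e = {i, j}" "i \<noteq> j" "i \<in> V" "j \<in> V"
proof -
  have "card e = 2" "e \<subseteq> V" using edges[OF assms] by auto
  then show thesis using that by (auto simp: card_2_iff)
qed

lemma edge_vec_cases:
  assumes "{i, j} \<in> E"
  shows "edge_vec B u {i, j} \<in> {vertex_vec B u i - vertex_vec B u j, vertex_vec B u j - vertex_vec B u i}"
proof -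
  consider "i \<notin> B" "j \<notin> B" | "i \<notin> B" "j \<in> B" | "i \<in> B" "j \<notin> B"
    using boundary_nonadjacent assms by blast
  then show ?thesis
  proof cases
    case 1
    then show ?thesis using edge_vec_interior[OF assms 1, of u] by (simp add: vertex_vec_def)
  next
    case 2
    then show ?thesis using edge_vec_boundary[OF assms 2, of u] by (simp add: vertex_vec_def)
  next
    case 3
    have "{j, i} \<in> E" using assms by (simp add: insert_commute)
    then show ?thesis
      using edge_vec_boundary[of j i u] 3 by (simp add: vertex_vec_def insert_commute)
  qed
qed

lemma potential_edge_vec:
  assumes "e \<in> E" "\<And>b. b \<in> B \<Longrightarrow> f b = u b * t" "\<And>i j. {i, j} = e \<Longrightarrow> f i = f j"
  shows "potential V B f t (edge_vec B u e) = 0"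
proof -
  obtain i j where ij: "e = {i, j}" "i \<in> V" "j \<in> V" using edgeE[OF assms(1)] by metis
  then have "f i = f j" using assms(3) by blast
  then show ?thesis
    using edge_vec_cases[of i j u] assms(1) ij finite_V assms(2)
    by (auto simp: linear_diff[OF linear_potential] potential_vertex_vec)
qed

text \<open>Edge vectors telescope along a path.\<close>

lemma vertex_vec_diff_in_span:
  assumes "Y \<subseteq> E" "edge_vec B u ` Y \<subseteq> span W" "(a, b) \<in> (adj Y)\<^sup>*"
  shows "vertex_vec B u a - vertex_vec B u b \<in> span W"
  using assms(3)
proof induction
  case base
  then show ?case by (simp add: span_zero)
next
  case (step b c)
  then have "{b, c} \<in> Y" by simp
  then have "edge_vec B u {b, c} \<in> span W" "{b, c} \<in> E" using assms by auto
  then have "vertex_vec B u b - vertex_vec B u c \<in> span W"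
    using edge_vec_cases[of b c u] span_neg[of "vertex_vec B u c - vertex_vec B u b" W] by auto
  from span_add[OF step.IH this] show ?case by simp
qed

text \<open>All boundary vertex vectors are multiples of \<open>basis_vec None\<close>; a path to
  \<open>B\<close> then yields the vector of each interior vertex.\<close>

lemma frame_subset_span:
  assumes Y: "Y \<subseteq> E" "edge_vec B u ` Y \<subseteq> span W" and None: "basis_vec None \<in> span W"
    and conn: "\<And>v. v \<in> V \<Longrightarrow> \<exists>b\<in>B. (v, b) \<in> (adj Y)\<^sup>*"
  shows "frame V B \<subseteq> span W"
proof -
  have "basis_vec (Some v) \<in> span W" if v: "v \<in> V - B" for v
  proof -
    obtain b where b: "b \<in> B" "(v, b) \<in> (adj Y)\<^sup>*" using conn v by auto
    have "vertex_vec B u b \<in> span W"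
      using b None by (simp add: vertex_vec_def span_scale)
    from span_add[OF vertex_vec_diff_in_span[OF Y b(2)] this] show ?thesis
      using v by (simp add: vertex_vec_def)
  qed
  then show ?thesis using None by (auto simp: frame_def)
qed

lemma edge_vec_in_span_frame: "e \<in> E \<Longrightarrow> edge_vec B u e \<in> span (frame V B)"
proof -
  have vert: "vertex_vec B u v \<in> span (frame V B)" if "v \<in> V" for v
    using that by (auto simp: vertex_vec_def frame_def intro!: span_scale intro: span_base)
  assume "e \<in> E"
  moreover obtain i j where "e = {i, j}" "i \<in> V" "j \<in> V"
    using edgeE[OF \<open>e \<in> E\<close>] by metis
  ultimately show ?thesis
    using edge_vec_cases[of i j u] span_diff[OF vert vert] by auto
qed

text \<open>Connectedness of the graph gives full rank, so \<open>frame V B\<close> can serve as the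
  reference basis in \<open>bases_vector_indep\<close>.\<close>

lemma dirichlet_bases:
  "bases (dirichlet_indep E B u) = {X. X \<subseteq> dirichlet_ground E \<and> card X = Suc (card (V - B)) \<and>
    frame V B \<subseteq> span (dirichlet_vec B u ` X)}"
proof -
  let ?S = "dirichlet_ground E" and ?w = "dirichlet_vec B u"
  have "?w ` ?S \<subseteq> span (frame V B)"
    using edge_vec_in_span_frame
    by (auto simp: dirichlet_ground_def dirichlet_vec_def frame_def intro: span_base)
  moreover have "frame V B \<subseteq> span (?w ` ?S)"
  proof (rule frame_subset_span[of E u])
    show "edge_vec B u ` E \<subseteq> span (?w ` ?S)"
      by (force simp: dirichlet_ground_def dirichlet_vec_def intro: span_base)
    show "basis_vec None \<in> span (?w ` ?S)"
      by (force simp: dirichlet_ground_def dirichlet_vec_def intro: span_base)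
    show "\<exists>b\<in>B. (v, b) \<in> (adj E)\<^sup>*" if v: "v \<in> V" for v
    proof -
      obtain b where "b \<in> B" using B_Diff_singleton_nonempty by blast
      then show ?thesis using connected[OF v, of b] boundary by blast
    qed
  qed simp
  moreover have "finite (frame V B)" using finite_V by (simp add: frame_def)
  ultimately show ?thesis
    unfolding dirichlet_indep_def card_frame[OF finite_V, of B, symmetric]
    by (intro bases_vector_indep finite_dirichlet_ground independent_frame)
qed

text \<open>A dual test for spanning: a functional vanishing on the vectors of \<open>X\<close>
  vanishes on the whole frame. Exhibiting a nonzero potential that is constant along the edges of
  \<open>X\<close> therefore refutes spanning.\<close>

lemma potential_zero:
  assumes "X \<subseteq> dirichlet_ground E" "frame V B \<subseteq> span (dirichlet_vec B u ` X)"
    and "\<And>b. b \<in> B \<Longrightarrow> f b = u b * t" "\<And>i j. Some {i, j} \<in> X \<Longrightarrow> f i = f j" "None \<in> X \<Longrightarrow> t = 0"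
  shows "t = 0" and "v \<in> V - B \<Longrightarrow> f v = 0"
proof -
  have "potential V B f t (dirichlet_vec B u a) = 0" if "a \<in> X" for a
  proof (cases a)
    case None
    then show ?thesis using that assms by (simp add: dirichlet_vec_def potential_None)
  next
    case (Some e)
    then have "Some e \<in> X" "e \<in> E" using that assms(1) by (auto simp: dirichlet_ground_def)
    then have "potential V B f t (edge_vec B u e) = 0"
      using assms(3,4) by (intro potential_edge_vec) simp_all
    then show ?thesis using Some by (simp add: dirichlet_vec_def)
  qed
  then have zero: "potential V B f t z = 0" if "z \<in> frame V B" for z
    using linear_eq_0_on_span[OF linear_potential, of "dirichlet_vec B u ` X"] that assms(2) by blast
  show "t = 0"
    using zero[of "basis_vec None"] by (simp add: frame_def potential_None)
  show "f v = 0" if "v \<in> V - B"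
    using zero[of "basis_vec (Some v)"] that finite_V by (simp add: frame_def potential_Some)
qed

text \<open>The indicator of the vertices not connected to \<open>B\<close> is constant along edges
  and 0 on \<open>B\<close>, so it is a potential with \<open>t = 0\<close> and must vanish.\<close>

lemma frame_span_connected:
  assumes X: "X \<subseteq> dirichlet_ground E" "frame V B \<subseteq> span (dirichlet_vec B u ` X)"
    and Y: "\<And>e. Some e \<in> X \<Longrightarrow> e \<in> Y" and "v \<in> V"
  shows "\<exists>b\<in>B. (v, b) \<in> (adj Y)\<^sup>*"
proof (cases "v \<in> B")
  case False
  define f :: "'v \<Rightarrow> real" where "f v = of_bool (\<not> (\<exists>b\<in>B. (v, b) \<in> (adj Y)\<^sup>*))" for v
  have "f v = 0"
  proof (rule potential_zero(2)[OF X, of f 0])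
    show "f b = u b * 0" if "b \<in> B" for b using that by (auto simp: f_def)
    show "f i = f j" if "Some {i, j} \<in> X" for i j
    proof -
      have "(i, j) \<in> adj Y" "(j, i) \<in> adj Y" using Y[OF that] by (auto simp: insert_commute)
      then show ?thesis unfolding f_def by (meson converse_rtrancl_into_rtrancl)
    qed
  qed (use False \<open>v \<in> V\<close> in auto)
  then show ?thesis by (simp add: f_def)
qed auto

text \<open>
  The edge sets that form a basis without \<open>e\<^sub>0\<close>: by cardinality, exactly two boundary nodes are
  connected.
\<close>
definition linking_forests :: "'v set set set" where
  "linking_forests = {Y. Y \<subseteq> E \<and> card Y = Suc (card (V - B)) \<and>
    (\<forall>v\<in>V. \<exists>b\<in>B. (v, b) \<in> (adj Y)\<^sup>*) \<and> (\<exists>k\<in>B. \<exists>l\<in>B. k \<noteq> l \<and> (k, l) \<in> (adj Y)\<^sup>*)}"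

lemma insert_None_in_bases_iff:
  assumes "Y \<subseteq> E"
  shows "insert None (Some ` Y) \<in> bases (dirichlet_indep E B u) \<longleftrightarrow> Y \<in> spanning_forests V E B"
proof -
  let ?X = "insert None (Some ` Y)"
  have "finite Y" using assms finite_E finite_subset by blast
  then have card: "card ?X = Suc (card Y)" by (simp add: card_image)
  have ground: "?X \<subseteq> dirichlet_ground E" using assms by (auto simp: dirichlet_ground_def)
  have "frame V B \<subseteq> span (dirichlet_vec B u ` ?X) \<longleftrightarrow> (\<forall>v\<in>V. \<exists>b\<in>B. (v, b) \<in> (adj Y)\<^sup>*)"
  proof
    assume frame: "frame V B \<subseteq> span (dirichlet_vec B u ` ?X)"
    show "\<forall>v\<in>V. \<exists>b\<in>B. (v, b) \<in> (adj Y)\<^sup>*"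
    proof
      show "\<exists>b\<in>B. (v, b) \<in> (adj Y)\<^sup>*" if "v \<in> V" for v
        by (rule frame_span_connected[OF ground frame _ that]) auto
    qed
  next
    assume conn: "\<forall>v\<in>V. \<exists>b\<in>B. (v, b) \<in> (adj Y)\<^sup>*"
    show "frame V B \<subseteq> span (dirichlet_vec B u ` ?X)"
    proof (rule frame_subset_span[OF assms])
      show "edge_vec B u ` Y \<subseteq> span (dirichlet_vec B u ` ?X)"
        by (force simp: dirichlet_vec_def intro: span_base)
      show "basis_vec None \<in> span (dirichlet_vec B u ` ?X)"
        by (force simp: dirichlet_vec_def intro: span_base)
    qed (use conn in auto)
  qed
  then show ?thesis
    using assms card ground by (auto simp: dirichlet_bases spanning_forests_def)
qed

text \<open>A path between boundary nodes \<open>k\<close> and \<open>l\<close> yields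
  \<open>u k - u l\<close> times \<open>basis_vec None\<close>, nonzero by injectivity of
  \<open>u\<close>. Without such a path \<open>basis_vec None\<close> is out of reach.\<close>

lemma Some_image_in_bases_iff:
  assumes "inj_on u B" "Y \<subseteq> E"
  shows "Some ` Y \<in> bases (dirichlet_indep E B u) \<longleftrightarrow> Y \<in> linking_forests"
proof -
  let ?X = "Some ` Y" and ?W = "dirichlet_vec B u ` Some ` Y"
  have ground: "?X \<subseteq> dirichlet_ground E" using assms by (auto simp: dirichlet_ground_def)
  have "frame V B \<subseteq> span ?W \<longleftrightarrow> (\<forall>v\<in>V. \<exists>b\<in>B. (v, b) \<in> (adj Y)\<^sup>*) \<and>
    (\<exists>k\<in>B. \<exists>l\<in>B. k \<noteq> l \<and> (k, l) \<in> (adj Y)\<^sup>*)"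
  proof (intro iffI conjI)
    assume frame: "frame V B \<subseteq> span ?W"
    show "\<forall>v\<in>V. \<exists>b\<in>B. (v, b) \<in> (adj Y)\<^sup>*"
    proof
      show "\<exists>b\<in>B. (v, b) \<in> (adj Y)\<^sup>*" if "v \<in> V" for v
        by (rule frame_span_connected[OF ground frame _ that]) auto
    qed
    show "\<exists>k\<in>B. \<exists>l\<in>B. k \<noteq> l \<and> (k, l) \<in> (adj Y)\<^sup>*"
    proof (rule ccontr)
      assume "\<not> ?thesis"
      then have neg: "l = k" if "k \<in> B" "l \<in> B" "(k, l) \<in> (adj Y)\<^sup>*" for k l
        using that by auto
      \<comment> \<open>Each vertex inherits the value of \<open>u\<close> at the boundary node of
        its component, unique by \<open>neg\<close>; this is a potential with
        \<open>t = 1\<close>.\<close>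
      define f where "f v = u (SOME b. b \<in> B \<and> (v, b) \<in> (adj Y)\<^sup>*)" for v
      have "(1::real) = 0"
      proof (rule potential_zero(1)[OF ground frame, of f])
        show "f b = u b * 1" if "b \<in> B" for b
        proof -
          have "(SOME c. c \<in> B \<and> (b, c) \<in> (adj Y)\<^sup>*) = b"
          proof (rule some_equality)
            show "c = b" if "c \<in> B \<and> (b, c) \<in> (adj Y)\<^sup>*" for c
              using that by (intro neg[OF \<open>b \<in> B\<close>]) simp_all
          qed (use that in simp)
          then show ?thesis by (simp add: f_def)
        qed
        show "f i = f j" if "Some {i, j} \<in> ?X" for i j
        proof -
          have "(i, j) \<in> adj Y" "(j, i) \<in> adj Y" using that by (auto simp: insert_commute)
          then have "(i, b) \<in> (adj Y)\<^sup>* \<longleftrightarrow> (j, b) \<in> (adj Y)\<^sup>*" for b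
            by (meson converse_rtrancl_into_rtrancl)
          then show ?thesis by (simp add: f_def)
        qed
      qed auto
      then show False by simp
    qed
  next
    assume "(\<forall>v\<in>V. \<exists>b\<in>B. (v, b) \<in> (adj Y)\<^sup>*) \<and> (\<exists>k\<in>B. \<exists>l\<in>B. k \<noteq> l \<and> (k, l) \<in> (adj Y)\<^sup>*)"
    then obtain k l where conn: "\<forall>v\<in>V. \<exists>b\<in>B. (v, b) \<in> (adj Y)\<^sup>*"
      and kl: "k \<in> B" "l \<in> B" "k \<noteq> l" "(k, l) \<in> (adj Y)\<^sup>*" by blast
    have edge: "edge_vec B u ` Y \<subseteq> span ?W"
      by (force simp: dirichlet_vec_def intro: span_base)
    have "(u k - u l) *\<^sub>R basis_vec None \<in> span ?W"
      using vertex_vec_diff_in_span[OF assms(2) edge kl(4)] kl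
      by (simp add: vertex_vec_def scaleR_diff_left)
    then have "(1 / (u k - u l)) *\<^sub>R ((u k - u l) *\<^sub>R basis_vec None) \<in> span ?W"
      by (rule span_scale)
    moreover have "u k - u l \<noteq> 0" using kl assms(1) by (auto dest: inj_onD)
    ultimately have "basis_vec None \<in> span ?W" by simp
    then show "frame V B \<subseteq> span ?W"
      using frame_subset_span[OF assms(2) edge] conn by blast
  qed
  then show ?thesis
    using assms ground by (auto simp: dirichlet_bases linking_forests_def card_image)
qed

section \<open>Double counting of linking forests\<close>

lemma card_Diff_root: "k \<in> B \<Longrightarrow> card (V - (B - {k})) = Suc (card (V - B))"
proof -
  assume "k \<in> B"
  then have "V - (B - {k}) = insert k (V - B)" using boundary by auto
  with \<open>k \<in> B\<close> finite_V show ?thesis by simp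
qed

text \<open>A root may be dropped if it is connected to another boundary node, as \<open>k\<close>
  and \<open>l\<close> are. If a third root \<open>m\<close> could be dropped, then \<open>m\<close>
  and \<open>k\<close> could be dropped together, which requires one edge more than \<open>Y\<close>
  has.\<close>

lemma linking_forest_roots:
  assumes Y: "Y \<in> linking_forests" and kl: "k \<in> B" "l \<in> B" "k \<noteq> l" "(k, l) \<in> (adj Y)\<^sup>*"
  shows "{m \<in> B. Y \<in> spanning_forests V E (B - {m})} = {k, l}"
proof -
  have good: "Y \<in> spanning_forests V E (B - {a})" if "a \<in> B" "b \<in> B" "a \<noteq> b" "(a, b) \<in> (adj Y)\<^sup>*" for a b
  proof -
    have "\<exists>r\<in>B - {a}. (v, r) \<in> (adj Y)\<^sup>*" if "v \<in> V" for v
    proof -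
      obtain r where r: "r \<in> B" "(v, r) \<in> (adj Y)\<^sup>*" using Y \<open>v \<in> V\<close> by (auto simp: linking_forests_def)
      then show ?thesis
        using \<open>a \<noteq> b\<close> \<open>b \<in> B\<close> \<open>(a, b) \<in> (adj Y)\<^sup>*\<close>
        by (cases "r = a") (auto intro: rtrancl_trans)
    qed
    then show ?thesis
      using Y \<open>a \<in> B\<close> card_Diff_root by (auto simp: spanning_forests_def linking_forests_def)
  qed
  have "m = k \<or> m = l" if m: "m \<in> B" "Y \<in> spanning_forests V E (B - {m})" for m
  proof (rule ccontr)
    assume neg: "\<not> ?thesis"
    have "\<exists>r\<in>B - {m} - {k}. (v, r) \<in> (adj Y)\<^sup>*" if "v \<in> V" for v
    proof -
      obtain r where r: "r \<in> B - {m}" "(v, r) \<in> (adj Y)\<^sup>*"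
        using m \<open>v \<in> V\<close> by (auto simp: spanning_forests_def)
      then show ?thesis
        using kl neg by (cases "r = k") (auto intro: rtrancl_trans)
    qed
    moreover have "Y \<subseteq> E" using Y by (simp add: linking_forests_def)
    ultimately have "card (V - (B - {m} - {k})) \<le> card Y"
      using Union_E finite_E finite_subset by (intro card_connected_edges_ge) auto
    moreover have "V - (B - {m} - {k}) = insert k (V - (B - {m}))"
      using boundary kl by auto
    moreover have "k \<notin> V - (B - {m})" using kl neg by auto
    ultimately show False
      using finite_V m Y by (simp add: card_Diff_root linking_forests_def)
  qed
  then show ?thesis
    using good[OF kl] good[OF kl(2,1) _ adj_rtrancl_sym[OF kl(4)]] kl by auto
qed

text \<open>The dropped root \<open>k\<close> is still a vertex, so it is connected to some boundary
  node other than itself.\<close>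

lemma spanning_forest_linking:
  assumes "k \<in> B" "Y \<in> spanning_forests V E (B - {k})"
  shows "Y \<in> linking_forests"
proof -
  have "k \<in> V" using assms boundary by auto
  then obtain l where "l \<in> B" "k \<noteq> l" "(k, l) \<in> (adj Y)\<^sup>*"
    using assms by (auto simp: spanning_forests_def)
  then have "\<exists>k\<in>B. \<exists>l\<in>B. k \<noteq> l \<and> (k, l) \<in> (adj Y)\<^sup>*" using assms(1) by blast
  moreover have "\<forall>v\<in>V. \<exists>b\<in>B. (v, b) \<in> (adj Y)\<^sup>*"
    using assms(2) unfolding spanning_forests_def by blast
  ultimately show ?thesis
    using assms card_Diff_root[OF assms(1)] by (simp add: linking_forests_def spanning_forests_def)
qed

lemma basis_gen_poly_dirichlet:
  assumes "inj_on u B"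
  defines "c \<equiv> \<lambda>x. conductance E (\<lambda>e. x (Some e))"
  shows "basis_gen_poly (dirichlet_indep E B u) x =
    x None * forest_sum V (c x) B + (\<Sum>k\<in>B. forest_sum V (c x) (B - {k})) / 2"
proof -
  let ?m = "\<lambda>Y. \<Prod>e\<in>Y. x (Some e)"
  have fin: "finite (spanning_forests V E R)" "finite linking_forests" for R
    using finite_E by (auto simp: spanning_forests_def linking_forests_def
        intro: finite_subset[OF _ finite_Pow_iff[THEN iffD2]])
  have sub: "Y \<subseteq> E" if "Y \<in> spanning_forests V E R \<or> Y \<in> linking_forests" for Y R
    using that by (auto simp: spanning_forests_def linking_forests_def)
  have bases: "bases (dirichlet_indep E B u) =
      (\<lambda>Y. insert None (Some ` Y)) ` spanning_forests V E B \<union> (`) Some ` linking_forests" (is "_ = ?A \<union> ?C")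
  proof (intro equalityI subsetI)
    fix X
    assume X: "X \<in> bases (dirichlet_indep E B u)"
    define Y where "Y = {e. Some e \<in> X}"
    have "Y \<subseteq> E" using X by (auto simp: dirichlet_bases dirichlet_ground_def Y_def)
    have "X = (if None \<in> X then insert None (Some ` Y) else Some ` Y)"
    proof (rule set_eqI)
      show "a \<in> X \<longleftrightarrow> a \<in> (if None \<in> X then insert None (Some ` Y) else Some ` Y)" for a
        by (cases a) (auto simp: Y_def)
    qed
    then show "X \<in> ?A \<union> ?C"
      using X insert_None_in_bases_iff[OF \<open>Y \<subseteq> E\<close>] Some_image_in_bases_iff[OF assms(1) \<open>Y \<subseteq> E\<close>]
      by (cases "None \<in> X") auto
  next
    fix X
    assume "X \<in> ?A \<union> ?C"
    then show "X \<in> bases (dirichlet_indep E B u)"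
      using sub insert_None_in_bases_iff Some_image_in_bases_iff[OF assms(1)] by blast
  qed
  have "?A \<inter> ?C = {}" by auto
  then have "basis_gen_poly (dirichlet_indep E B u) x =
      (\<Sum>X\<in>?A. \<Prod>e\<in>X. x e) + (\<Sum>X\<in>?C. \<Prod>e\<in>X. x e)"
    unfolding basis_gen_poly_def bases using fin by (intro sum.union_disjoint) auto
  also have "(\<Sum>X\<in>?A. \<Prod>e\<in>X. x e) = x None * forest_sum V (c x) B"
  proof -
    have "inj_on (\<lambda>Y. insert None (Some ` Y)) (spanning_forests V E B)"
      by (rule inj_onI) auto
    then have "(\<Sum>X\<in>?A. \<Prod>e\<in>X. x e) =
        (\<Sum>Y\<in>spanning_forests V E B. \<Prod>e\<in>insert None (Some ` Y). x e)"
      by (simp only: sum.reindex o_def)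
    also have "\<dots> = (\<Sum>Y\<in>spanning_forests V E B. x None * ?m Y)"
    proof (intro sum.cong refl)
      fix Y assume "Y \<in> spanning_forests V E B"
      then have "finite Y" using sub finite_E finite_subset by blast
      then show "(\<Prod>e\<in>insert None (Some ` Y). x e) = x None * ?m Y"
        by (subst prod.insert) (auto simp: prod.reindex)
    qed
    finally show ?thesis
      by (simp add: c_def forest_sum_conductance[OF finite_V Union_E] sum_distrib_left)
  qed
  also have "(\<Sum>X\<in>?C. \<Prod>e\<in>X. x e) = (\<Sum>Y\<in>linking_forests. ?m Y)"
    by (subst sum.reindex) (auto simp: inj_on_def prod.reindex)
  \<comment> \<open>Pairs of a linking forest and a root that it can drop are counted in two ways;
    each forest occurs in exactly two pairs, whence the half.\<close>
  also have "\<dots> = (\<Sum>k\<in>B. forest_sum V (c x) (B - {k})) / 2"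
  proof -
    have "(\<Sum>k\<in>B. forest_sum V (c x) (B - {k})) =
        (\<Sum>k\<in>B. \<Sum>Y\<in>linking_forests. of_bool (Y \<in> spanning_forests V E (B - {k})) * ?m Y)"
      unfolding c_def forest_sum_conductance[OF finite_V Union_E]
      using spanning_forest_linking fin by (intro sum.cong sum.mono_neutral_cong_left) auto
    also have "\<dots> = (\<Sum>Y\<in>linking_forests. \<Sum>k\<in>B. of_bool (Y \<in> spanning_forests V E (B - {k})) * ?m Y)"
      by (rule sum.swap)
    also have "\<dots> = (\<Sum>Y\<in>linking_forests. 2 * ?m Y)"
    proof (intro sum.cong refl)
      fix Y assume Y: "Y \<in> linking_forests"
      then obtain k l where kl: "k \<in> B" "l \<in> B" "k \<noteq> l" "(k, l) \<in> (adj Y)\<^sup>*"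
        unfolding linking_forests_def by blast
      have "(\<Sum>k\<in>B. of_bool (Y \<in> spanning_forests V E (B - {k})) * ?m Y) =
          of_nat (card {m \<in> B. Y \<in> spanning_forests V E (B - {m})}) * ?m Y"
        using finite_B by (simp add: sum_distrib_right[symmetric] sum.If_cases Int_def)
      also have "\<dots> = 2 * ?m Y"
        unfolding linking_forest_roots[OF Y kl] using \<open>k \<noteq> l\<close> by simp
      finally show "(\<Sum>k\<in>B. of_bool (Y \<in> spanning_forests V E (B - {k})) * ?m Y) = 2 * ?m Y" .
    qed
    finally show ?thesis by (simp add: sum_distrib_left[symmetric])
  qed
  finally show ?thesis .
qed

end

section \<open>The half-plane property from effective conductances\<close>

theorem theorem1p1:
  fixes V :: "'v set" and E :: "'v set set" and B :: "'v set" and u :: "'v \<Rightarrow> real"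
  assumes "network V E B" and "inj_on u B"
  shows "half_plane_property (dirichlet_ground E) (dirichlet_indep E B u)"
  unfolding half_plane_property_def
proof (intro conjI allI impI)
  interpret network V E B by fact
  show "matroid (dirichlet_ground E) (dirichlet_indep E B u)"
    by (rule matroid_dirichlet)
  fix x :: "'v set option \<Rightarrow> complex"
  assume pos: "\<forall>e\<in>dirichlet_ground E. Im (x e) > 0"
  define c where "c = conductance E (\<lambda>e. x (Some e))"
  define T where "T = forest_sum V c"
  have sym: "c a w = c w a" for a w
    by (simp add: c_def conductance_def insert_commute)
  have adj: "Im (c a w) > 0" if "{a, w} \<in> E" for a w
    using pos that by (simp add: c_def conductance_def dirichlet_ground_def)
  have nonneg: "Im (c a w) \<ge> 0" for a w
    using adj[of a w] by (cases "{a, w} \<in> E") (auto simp: c_def conductance_def)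
  have conn: "(a, w) \<in> {(a, w). a \<in> V \<and> w \<in> V \<and> Im (c a w) > 0}\<^sup>*" if "a \<in> V" "w \<in> V" for a w
  proof (rule rtrancl_mono[THEN subsetD])
    show "adj E \<subseteq> {(a, w). a \<in> V \<and> w \<in> V \<and> Im (c a w) > 0}"
      using adj Union_E by auto
  qed (rule connected[OF that])
  note graph = finite_V sym nonneg conn
  have "B \<noteq> {}" using boundary_ge_2 by auto
  have TB: "T B \<noteq> 0"
    unfolding T_def
    by (rule forest_sum_nonzero[OF graph]) (use boundary \<open>B \<noteq> {}\<close> in auto)
  have ratio: "Im (T (B - {k}) / T B) > 0" if "k \<in> B" for k
  proof -
    have "insert k (B - {k}) = B" using that by auto
    then show ?thesis
      using forest_sum_ratio[OF graph, of "B - {k}" k] TB boundary that B_Diff_singleton_nonempty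
      unfolding T_def by auto
  qed
  \<comment> \<open>Dividing by the nonzero \<open>T B\<close> leaves \<open>x None\<close> plus
    half a sum of effective conductances, all of positive imaginary part.\<close>
  have "basis_gen_poly (dirichlet_indep E B u) x / T B = x None + (\<Sum>k\<in>B. T (B - {k}) / T B) / 2"
    using TB
    by (simp add: basis_gen_poly_dirichlet[OF assms(2)] T_def c_def add_divide_distrib sum_divide_distrib mult.commute)
  moreover have "Im (x None + (\<Sum>k\<in>B. T (B - {k}) / T B) / 2) > 0"
  proof -
    have "Im (\<Sum>k\<in>B. T (B - {k}) / T B) \<ge> 0"
      unfolding Im_sum using ratio by (intro sum_nonneg) (auto intro: less_imp_le)
    moreover have "Im (x None) > 0" using pos by (simp add: dirichlet_ground_def)
    ultimately show ?thesis by simp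
  qed
  ultimately have "Im (basis_gen_poly (dirichlet_indep E B u) x / T B) > 0" by (simp only:)
  then show "basis_gen_poly (dirichlet_indep E B u) x \<noteq> 0" by auto
qed

end
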